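(* Let $X$ be a separable $F$-space and let $T$ be a continuous linear operator on $X$. If $T$ is reiteratively hypercyclic, then $T$ is topologically ergodic.
   Context: An $F$-space is a topological vector space whose topology is induced by a complete translation-invariant metric. For $A\subseteq\mathbb{Z}_+$ (the non-negative integers), the upper Banach density is $\overline{Bd}(A)=\lim_{s\to\infty}\alpha^s/s$, where $\alpha^s=\limsup_{k\to\infty}|A\cap[k+1,k+s]|$ (the limit always exists). For $x\in X$ and $V\subset X$, $N(x,V)=\{n\ge0:T^nx\in V\}$. $T$ is reiteratively hypercyclic if there exists $x\in X$ such that $\overline{Bd}(N(x,V))>0$ for every non-empty open $V\subset X$. $T$ is topologically ergodic if for any non-empty open sets $U,V\subset X$ the set $N(U,V)=\{n\ge0:T^nU\cap V\ne\emptyset\}$ is syndetic, i.e. it is infinite and has bounded gaps. *)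

theory Defs
  imports "HOL-Analysis.Analysis"
begin

text \<open>By the Gelfand-Mazur theorem the instances of \<^class>\<open>real_normed_field\<close> are, up to isomorphism,
  exactly the real and the complex numbers, so both real and complex spaces are covered.\<close>

locale topological_vector_space = vector_space scale
  for scale :: "'k::real_normed_field \<Rightarrow> 'a::topological_ab_group_add \<Rightarrow> 'a" +
  assumes continuous_scale: "continuous_on UNIV (\<lambda>(c, x). scale c x)"

locale F_space = topological_vector_space scale
  for scale :: "'k::real_normed_field \<Rightarrow> 'a::topological_ab_group_add \<Rightarrow> 'a" +
  assumes complete_invariant_metric:
    "\<exists>d. Metric_space (UNIV :: 'a set) d \<and>
         Metric_space.mcomplete UNIV d \<and>
         (\<forall>x y z. d (x + z) (y + z) = d x y) \<and>
         Metric_space.mtopology UNIV d = euclidean"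

definition window_limsup :: "nat set \<Rightarrow> nat \<Rightarrow> ereal" where
  "window_limsup A s = limsup (\<lambda>k. ereal (real (card (A \<inter> {k + 1..k + s}))))"

text \<open>The limit exists for every set because \<^const>\<open>window_limsup\<close> is subadditive in the window
  length; \<^const>\<open>lim\<close> therefore never takes an unspecified value here.\<close>

definition upper_Banach_density :: "nat set \<Rightarrow> ereal" where
  "upper_Banach_density A = lim (\<lambda>s. window_limsup A s / ereal (real s))"

definition return_times :: "('a \<Rightarrow> 'a) \<Rightarrow> 'a \<Rightarrow> 'a set \<Rightarrow> nat set" where
  "return_times T x V = {n. (T ^^ n) x \<in> V}"

definition hitting_times :: "('a \<Rightarrow> 'a) \<Rightarrow> 'a set \<Rightarrow> 'a set \<Rightarrow> nat set" where
  "hitting_times T U V = {n. (T ^^ n) ` U \<inter> V \<noteq> {}}"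

definition syndetic :: "nat set \<Rightarrow> bool" where
  "syndetic A \<longleftrightarrow> infinite A \<and> (\<exists>g. \<forall>m\<in>A. \<exists>n\<in>A. m < n \<and> n \<le> m + g)"

definition reiteratively_hypercyclic :: "('a::topological_space \<Rightarrow> 'a) \<Rightarrow> bool" where
  "reiteratively_hypercyclic T \<longleftrightarrow>
     (\<exists>x. \<forall>V. open V \<and> V \<noteq> {} \<longrightarrow> upper_Banach_density (return_times T x V) > 0)"

definition topologically_ergodic :: "('a::topological_space \<Rightarrow> 'a) \<Rightarrow> bool" where
  "topologically_ergodic T \<longleftrightarrow>
     (\<forall>U V. open U \<and> U \<noteq> {} \<and> open V \<and> V \<noteq> {} \<longrightarrow> syndetic (hitting_times T U V))"

end

theory Submission
  imports Defs
begin

text \<open>Topological ergodicity reduces to the case of a single open set \<open>W\<close>, where it becomes a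
  statement about one set of natural numbers. If \<open>a\<close> and \<open>a + n\<close> are both return times of \<open>x\<close> to
  \<open>W\<close>, then \<open>n\<close> is a hitting time from \<open>W\<close> to \<open>W\<close>, witnessed by the point \<open>(T ^^ a) x\<close>. So the
  hitting times from \<open>W\<close> to itself contain all positive differences of a set of positive upper
  Banach density, and such a difference set has bounded gaps
  (\<open>bounded_gaps_differences\<close>).

  The bounded gaps come from a packing argument: if the differences of \<open>A\<close> had arbitrarily long
  gaps, one could find arbitrarily many pairwise disjoint translates of \<open>A\<close>. All of them fill the
  same proportion of a long window that is rich in \<open>A\<close>, up to a bounded shift, so together they
  would occupy more room than the window has.

  For two open sets \<open>U\<close> and \<open>V\<close>, the orbit of \<open>x\<close> meets \<open>U\<close> and, at a later time, \<open>V\<close>. Hence for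
  some \<open>n\<close> the set \<open>W\<close> of the points of \<open>U\<close> that \<open>T ^^ n\<close> maps into \<open>V\<close> is open and non-empty, and
  every hitting time from \<open>W\<close> to \<open>W\<close>, increased by \<open>n\<close>, is a hitting time from \<open>U\<close> to \<open>V\<close>.\<close>

text \<open>Measuring gaps from every natural number, rather than only from elements of the set as in
  \<^const>\<open>syndetic\<close>, makes the property visibly stable under passing to larger sets.\<close>

definition bounded_gaps :: "nat set \<Rightarrow> bool" where
  "bounded_gaps A \<longleftrightarrow> (\<exists>g. \<forall>m. \<exists>n\<in>A. m < n \<and> n \<le> m + g)"

definition differences :: "nat set \<Rightarrow> nat set" where
  "differences A = {n. \<exists>a\<in>A. a + n \<in> A}"

lemma bounded_gaps_imp_syndetic:
  assumes "bounded_gaps A"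
  shows "syndetic A"
  using assms unfolding bounded_gaps_def syndetic_def infinite_nat_iff_unbounded by blast

lemma bounded_gaps_translate_mono:
  assumes "bounded_gaps A" and "\<And>a. a \<in> A \<Longrightarrow> a + n \<in> B"
  shows "bounded_gaps B"
proof -
  obtain g where g: "\<And>m. \<exists>a\<in>A. m < a \<and> a \<le> m + g"
    using assms(1) unfolding bounded_gaps_def by blast
  have "\<exists>b\<in>B. m < b \<and> b \<le> m + (g + n)" for m
  proof -
    obtain a where "a \<in> A" "m < a" "a \<le> m + g"
      using g by blast
    then show ?thesis
      by (intro bexI[of _ "a + n"]) (use assms(2) in auto)
  qed
  then show ?thesis
    unfolding bounded_gaps_def by blast
qed

text \<open>If all long windows were sparse, the quotients defining the density would tend to \<open>0\<close>, which
  determines the value of \<^const>\<open>lim\<close>. Arguing by contraposition in this way gives dense windows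
  without first establishing that the limit exists.\<close>

lemma upper_Banach_density_pos_imp_dense_windows:
  assumes "upper_Banach_density A > 0"
  obtains \<delta> :: real where "\<delta> > 0"
    and "\<And>L. \<exists>s\<ge>L. \<exists>k. \<delta> * real s < real (card (A \<inter> {k + 1..k + s}))"
proof (rule ccontr)
  assume "\<not> thesis"
  with that have sparse:
    "\<exists>L. \<forall>s\<ge>L. \<forall>k. real (card (A \<inter> {k + 1..k + s})) \<le> \<delta> * real s" if "\<delta> > 0" for \<delta>
    using \<open>\<delta> > 0\<close> by (meson not_le)
  let ?f = "\<lambda>s. window_limsup A s / ereal (real s)"
  have nonneg: "0 \<le> window_limsup A s" for s
    unfolding window_limsup_def by (intro le_Limsup) auto
  have "?f \<longlonglongrightarrow> 0"
  proof (rule order_tendstoI)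
    fix e :: ereal
    assume "e < 0"
    moreover have "0 \<le> ?f s" for s
      using nonneg[of s] ereal_divide_right_mono[of 0 "window_limsup A s" "ereal (real s)"]
      by (cases "s = 0") auto
    ultimately show "\<forall>\<^sub>F s in sequentially. e < ?f s"
      by (intro always_eventually allI) (rule less_le_trans)
  next
    fix e :: ereal
    assume "0 < e"
    then obtain \<delta> where \<delta>: "0 < ereal \<delta>" "ereal \<delta> < e"
      using ereal_dense2 by blast
    then obtain L where L: "\<And>s k. s \<ge> L \<Longrightarrow> real (card (A \<inter> {k + 1..k + s})) \<le> \<delta> * real s"
      using sparse[of \<delta>] by auto
    have "?f s < e" if "s \<ge> max L 1" for s
    proof -
      have "window_limsup A s \<le> ereal (\<delta> * real s)"
        unfolding window_limsup_def using that L[of s]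
        by (intro Limsup_bounded always_eventually) auto
      then have "?f s \<le> ereal (\<delta> * real s) / ereal (real s)"
        using that by (intro ereal_divide_right_mono) auto
      also have "\<dots> = ereal \<delta>"
        using that by simp
      finally show ?thesis
        using \<delta>(2) by simp
    qed
    then show "\<forall>\<^sub>F s in sequentially. ?f s < e"
      unfolding eventually_sequentially by blast
  qed
  then have "upper_Banach_density A = 0"
    unfolding upper_Banach_density_def by (rule limI)
  with assms show False
    by simp
qed

text \<open>A gap in \<open>D\<close> that is longer than all shifts chosen so far leaves room for one more shift whose
  distances to the earlier ones all fall into the gap. When \<open>D\<close> consists of the differences of a
  set \<open>A\<close>, avoiding \<open>D\<close> means that the translates of \<open>A\<close> by the elements of \<open>F\<close> are pairwise
  disjoint.\<close>

lemma not_bounded_gaps_imp_avoiding_shifts: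
  assumes "\<not> bounded_gaps D"
  shows "\<exists>F. finite F \<and> card F = N \<and> (\<forall>t\<in>F. \<forall>u\<in>F. t < u \<longrightarrow> u - t \<notin> D)"
proof (induction N)
  case 0
  show ?case
    by (rule exI[of _ "{}"]) simp
next
  case (Suc N)
  then obtain F where F: "finite F" "card F = N" "\<And>t u. t \<in> F \<Longrightarrow> u \<in> F \<Longrightarrow> t < u \<Longrightarrow> u - t \<notin> D"
    by blast
  obtain B where B: "\<And>t. t \<in> F \<Longrightarrow> t \<le> B"
    using Max_ge[OF \<open>finite F\<close>] by blast
  obtain m where m: "\<And>n. m < n \<Longrightarrow> n \<le> m + (B + 1) \<Longrightarrow> n \<notin> D"
    using assms unfolding bounded_gaps_def by blast
  let ?v = "m + (B + 1)"
  have large: "t < ?v" if "t \<in> F" for t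
    using B[OF that] by simp
  have "u - t \<notin> D" if tu: "t \<in> insert ?v F" "u \<in> insert ?v F" "t < u" for t u
  proof (cases "u = ?v")
    case True
    then have "t \<in> F"
      using tu by auto
    then show ?thesis
      using B[of t] True by (intro m) auto
  next
    case False
    then have "u \<in> F"
      using tu by auto
    then have "t \<in> F"
      using tu large[of u] by auto
    then show ?thesis
      using F(3) \<open>u \<in> F\<close> tu(3) by blast
  qed
  moreover have "card (insert ?v F) = Suc N"
    using F(1,2) large by (subst card_insert_disjoint) auto
  ultimately show ?case
    using F(1) by (intro exI[of _ "insert ?v F"]) simp
qed

text \<open>Pairwise disjoint translates of the part of \<open>A\<close> in a window all stay inside the window
  lengthened by the largest shift.\<close>

lemma card_window_avoiding_shifts:
  assumes "finite F" and bound: "\<And>t. t \<in> F \<Longrightarrow> t \<le> B"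
    and avoid: "\<And>t u. t \<in> F \<Longrightarrow> u \<in> F \<Longrightarrow> t < u \<Longrightarrow> u - t \<notin> differences A"
  shows "card F * card (A \<inter> {k + 1..k + s}) \<le> s + B"
proof -
  let ?W = "A \<inter> {k + 1..k + s}"
  have inj: "inj_on (\<lambda>(t, a). a + t) (F \<times> ?W)"
  proof -
    have no_less: "\<not> t < u" if "t \<in> F" "u \<in> F" "a \<in> A" "b \<in> A" "a + t = b + u" for t u a b
    proof
      assume "t < u"
      then have "b + (u - t) = a"
        using that by simp
      then have "u - t \<in> differences A"
        using that unfolding differences_def by blast
      then show False
        using avoid that \<open>t < u\<close> by blast
    qed
    have "t = u \<and> a = b" if "t \<in> F" "u \<in> F" "a \<in> A" "b \<in> A" "a + t = b + u" for t u a b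
      using no_less[of t u a b] no_less[of u t b a] that by fastforce
    then show ?thesis
      by (auto simp: inj_on_def)
  qed
  have "card F * card ?W = card ((\<lambda>(t, a). a + t) ` (F \<times> ?W))"
    by (simp only: card_image[OF inj] card_cartesian_product)
  also have "\<dots> \<le> card {k + 1..k + s + B}"
    using bound by (intro card_mono) fastforce+
  finally show ?thesis
    by simp
qed

lemma bounded_gaps_differences:
  assumes "upper_Banach_density A > 0"
  shows "bounded_gaps (differences A)"
proof (rule ccontr)
  assume gaps: "\<not> bounded_gaps (differences A)"
  obtain \<delta> :: real where "\<delta> > 0"
    and dense: "\<And>L. \<exists>s\<ge>L. \<exists>k. \<delta> * real s < real (card (A \<inter> {k + 1..k + s}))"
    using upper_Banach_density_pos_imp_dense_windows[OF assms] by blast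
  \<comment> \<open>Enough shifts to cover a window of density \<open>\<delta>\<close> twice over.\<close>
  obtain N :: nat where N: "2 / \<delta> < real N"
    using reals_Archimedean2 by blast
  obtain F where F: "finite F" "card F = N"
    and avoid: "\<And>t u. t \<in> F \<Longrightarrow> u \<in> F \<Longrightarrow> t < u \<Longrightarrow> u - t \<notin> differences A"
    using not_bounded_gaps_imp_avoiding_shifts[OF gaps, of N] by blast
  obtain B where B: "\<And>t. t \<in> F \<Longrightarrow> t \<le> B"
    using Max_ge[OF \<open>finite F\<close>] by blast
  \<comment> \<open>The window is at least as long as every shift, so the translates fit into twice its length.\<close>
  obtain s k where "s \<ge> B" and c: "\<delta> * real s < real (card (A \<inter> {k + 1..k + s}))"
    using dense by blast
  have "0 < real N"
    using N \<open>\<delta> > 0\<close> by (smt (verit) divide_pos_pos)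
  have "2 * real s \<le> (real N * \<delta>) * real s"
    using N \<open>\<delta> > 0\<close> by (intro mult_right_mono) (auto simp: field_simps)
  also have "\<dots> < real N * real (card (A \<inter> {k + 1..k + s}))"
    using mult_strict_left_mono[OF c \<open>0 < real N\<close>] by (simp add: mult.assoc)
  also have "\<dots> \<le> real (s + B)"
    using card_window_avoiding_shifts[OF F(1) B avoid, of k s] F(2)
    by (metis of_nat_le_iff of_nat_mult)
  finally show False
    using \<open>s \<ge> B\<close> by simp
qed

lemma differences_return_times_subset:
  "differences (return_times T x W) \<subseteq> hitting_times T W W"
proof
  fix n
  assume "n \<in> differences (return_times T x W)"
  then obtain a where a: "(T ^^ a) x \<in> W" "(T ^^ (a + n)) x \<in> W"
    unfolding differences_def return_times_def by auto
  have "(T ^^ n) ((T ^^ a) x) \<in> W"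
    using a(2) by (subst (asm) add.commute) (simp add: funpow_add)
  with a(1) show "n \<in> hitting_times T W W"
    unfolding hitting_times_def by blast
qed

lemma hitting_times_preimage:
  assumes "m \<in> hitting_times T (U \<inter> (T ^^ n) -` V) (U \<inter> (T ^^ n) -` V)"
  shows "m + n \<in> hitting_times T U V"
proof -
  obtain w where "w \<in> U" "(T ^^ n) ((T ^^ m) w) \<in> V"
    using assms unfolding hitting_times_def by auto
  moreover have "(T ^^ (m + n)) w = (T ^^ n) ((T ^^ m) w)"
    by (metis add.commute comp_apply funpow_add)
  ultimately show ?thesis
    unfolding hitting_times_def by auto
qed

lemma reiteratively_hypercyclic_imp_topologically_ergodic:
  fixes T :: "'a::topological_space \<Rightarrow> 'a"
  assumes cont: "continuous_on UNIV T" and "reiteratively_hypercyclic T"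
  shows "topologically_ergodic T"
proof -
  obtain x where x: "\<And>V. open V \<Longrightarrow> V \<noteq> {} \<Longrightarrow> upper_Banach_density (return_times T x V) > 0"
    using assms(2) unfolding reiteratively_hypercyclic_def by blast
  have gaps: "bounded_gaps (differences (return_times T x V))" if "open V" "V \<noteq> {}" for V
    by (intro bounded_gaps_differences x that)
  have late: "\<exists>b>m. (T ^^ b) x \<in> V" if V: "open V" "V \<noteq> {}" for V m
  proof -
    obtain n where "n \<in> differences (return_times T x V)" "m < n"
      using gaps[OF V] unfolding bounded_gaps_def by blast
    then show ?thesis
      unfolding differences_def return_times_def by (auto intro: trans_less_add2)
  qed
  have cont_pow: "continuous_on UNIV (T ^^ n)" for n
  proof (induction n)
    case (Suc n)
    show ?case
      unfolding funpow.simps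
      by (rule continuous_on_compose[OF Suc.IH continuous_on_subset[OF cont subset_UNIV]])
  qed (simp add: id_def)
  have "syndetic (hitting_times T U V)" if U: "open U" "U \<noteq> {}" and V: "open V" "V \<noteq> {}" for U V
  proof -
    obtain a where a: "(T ^^ a) x \<in> U"
      using late[OF U] by blast
    obtain b where "a < b" and b: "(T ^^ b) x \<in> V"
      using late[OF V] by blast
    let ?n = "b - a"
    let ?W = "U \<inter> (T ^^ ?n) -` V"
    have "(T ^^ b) x = (T ^^ ?n) ((T ^^ a) x)"
      using \<open>a < b\<close> funpow_add[of ?n a T] by simp
    then have "(T ^^ ?n) ((T ^^ a) x) \<in> V"
      using b by simp
    then have "?W \<noteq> {}"
      using a by blast
    moreover have "open ?W"
      using U(1) V(1) cont_pow by (intro open_Int open_vimage)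
    ultimately have "bounded_gaps (differences (return_times T x ?W))"
      by (intro gaps)
    then have "bounded_gaps (hitting_times T U V)"
      by (rule bounded_gaps_translate_mono)
        (rule hitting_times_preimage[OF subsetD[OF differences_return_times_subset]])
    then show ?thesis
      by (rule bounded_gaps_imp_syndetic)
  qed
  then show ?thesis
    unfolding topologically_ergodic_def by blast
qed

theorem proposition25:
  fixes scale :: "'k::real_normed_field \<Rightarrow> 'a::topological_ab_group_add \<Rightarrow> 'a"
    and T :: "'a \<Rightarrow> 'a"
  assumes "F_space scale"
    and "separable_space (euclidean :: 'a topology)"
    and "Vector_Spaces.linear scale scale T"
    and "continuous_on UNIV T"
    and "reiteratively_hypercyclic T"
  shows "topologically_ergodic T"
  using assms(4,5) by (rule reiteratively_hypercyclic_imp_topologically_ergodic)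

end
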